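(* Let $p\in[2,\infty)$ and let $X$ be a $p$-uniformly PL-convex complex Banach space with $\dim X\ge2$. Then for every $n\in\mathbb N$, $$\Big(\frac{I_p(X)}{2^p+I_p(X)}\Big)^{2/p}\le r_p^n(X)\le1.$$
   Context: A complex Banach space $X$ is $p$-uniformly PL-convex ($2\le p<\infty$) if there is $\lambda>0$ with $\|x\|^p+\lambda\|y\|^p\le\frac1{2\pi}\int_0^{2\pi}\|x+e^{i\theta}y\|^p\,d\theta$ for all $x,y\in X$; $I_p(X)$ denotes the supremum of all such $\lambda$. For a holomorphic $f:\mathbb D^n\to X$ ($\mathbb D^n$ the open unit polydisk), $f(z)=x_0+\sum_{|\alpha|\ge1}x_\alpha z^\alpha$ (multi-index notation), with $\sup_{z\in\mathbb D^n}\|f(z)\|\le1$, let $r_p^n(f,X)=\sup\{r\ge0:\|x_0\|^p+\sum_{k\ge1}\sum_{|\alpha|=k}\|x_\alpha z^\alpha\|^p\le1\ \forall z\in r\mathbb D^n\}$ and $r_p^n(X)=\inf$ of $r_p^n(f,X)$ over all such $f$. *)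

theory Defs
  imports "HOL-Analysis.Analysis"
begin

class complex_normed_vector = real_normed_vector +
  fixes scaleC :: "complex \<Rightarrow> 'a \<Rightarrow> 'a"  (infixr \<open>*\<^sub>C\<close> 75)
  assumes scaleC_add_right: "scaleC a (x + y) = scaleC a x + scaleC a y"
    and scaleC_add_left: "scaleC (a + b) x = scaleC a x + scaleC b x"
    and scaleC_scaleC: "scaleC a (scaleC b x) = scaleC (a * b) x"
    and scaleC_one: "scaleC 1 x = x"
    and scaleC_of_real: "scaleC (of_real r) x = scaleR r x"
    and norm_scaleC: "norm (scaleC a x) = cmod a * norm x"

definition PL_ineq :: "real \<Rightarrow> real \<Rightarrow> 'a::complex_normed_vector itself \<Rightarrow> bool" where
  "PL_ineq p lam _ \<longleftrightarrow> (\<forall>x y :: 'a.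
     norm x powr p + lam * norm y powr p
       \<le> (1 / (2 * pi)) * integral {0..2*pi} (\<lambda>\<theta>. norm (x + cis \<theta> *\<^sub>C y) powr p))"

definition p_unif_PL_convex :: "real \<Rightarrow> 'a::complex_normed_vector itself \<Rightarrow> bool" where
  "p_unif_PL_convex p X \<longleftrightarrow> (\<exists>lam>0. PL_ineq p lam X)"

definition I_p :: "real \<Rightarrow> 'a::complex_normed_vector itself \<Rightarrow> real" where
  "I_p p X = Sup {lam. lam > 0 \<and> PL_ineq p lam X}"

definition cdim_ge2 :: "'a::complex_normed_vector itself \<Rightarrow> bool" where
  "cdim_ge2 _ \<longleftrightarrow> (\<exists>x y :: 'a. \<forall>a b :: complex.
       a *\<^sub>C x + b *\<^sub>C y = 0 \<longrightarrow> a = 0 \<and> b = 0)"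

text \<open>Points of C^n are functions nat => complex vanishing outside {..<n};
  multi-indices are functions nat => nat vanishing outside {..<n}.\<close>

definition polydisk :: "nat \<Rightarrow> (nat \<Rightarrow> complex) set" where
  "polydisk n = {z. (\<forall>i<n. cmod (z i) < 1) \<and> (\<forall>i\<ge>n. z i = 0)}"

definition multi_indices :: "nat \<Rightarrow> (nat \<Rightarrow> nat) set" where
  "multi_indices n = {\<alpha>. \<forall>i\<ge>n. \<alpha> i = 0}"

definition mono_pow :: "nat \<Rightarrow> (nat \<Rightarrow> complex) \<Rightarrow> (nat \<Rightarrow> nat) \<Rightarrow> complex" where
  "mono_pow n z \<alpha> = (\<Prod>i<n. z i ^ \<alpha> i)"

text \<open>f is holomorphic on the polydisk with Taylor coefficients c:
  f(z) = sum over all multi-indices of c_alpha z^alpha on the open unit polydisk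
  (the Taylor series of a holomorphic function on a polydisk converges
  unconditionally there, and conversely such a series defines a holomorphic function).\<close>

definition holo_powser :: "nat \<Rightarrow> ((nat \<Rightarrow> nat) \<Rightarrow> 'a::complex_normed_vector) \<Rightarrow> ((nat \<Rightarrow> complex) \<Rightarrow> 'a) \<Rightarrow> bool" where
  "holo_powser n c f \<longleftrightarrow>
     (\<forall>z\<in>polydisk n. ((\<lambda>\<alpha>. mono_pow n z \<alpha> *\<^sub>C c \<alpha>) has_sum f z) (multi_indices n))"

text \<open>Bohr-type radius r_p^n(f,X) (valued in extended reals, since it may be infinite).
  The sum over k >= 1 and |alpha| = k is the sum over all nonzero multi-indices
  of nonnegative terms, taken in ennreal.\<close>

definition bohr_cond :: "real \<Rightarrow> nat \<Rightarrow> ((nat \<Rightarrow> nat) \<Rightarrow> 'a::complex_normed_vector) \<Rightarrow> real \<Rightarrow> bool" where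
  "bohr_cond p n c r \<longleftrightarrow> (\<forall>z. (\<forall>i<n. cmod (z i) < r) \<and> (\<forall>i\<ge>n. z i = 0) \<longrightarrow>
      ennreal (norm (c (\<lambda>_. 0)) powr p)
        + (\<Sum>\<^sub>\<infinity>\<alpha>\<in>multi_indices n - {\<lambda>_. 0}. ennreal (norm (mono_pow n z \<alpha> *\<^sub>C c \<alpha>) powr p))
      \<le> 1)"

definition r_p_f :: "real \<Rightarrow> nat \<Rightarrow> ((nat \<Rightarrow> nat) \<Rightarrow> 'a::complex_normed_vector) \<Rightarrow> ereal" where
  "r_p_f p n c = Sup {ereal r | r. r \<ge> 0 \<and> bohr_cond p n c r}"

definition r_p :: "real \<Rightarrow> nat \<Rightarrow> 'a::{complex_normed_vector,banach} itself \<Rightarrow> ereal" where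
  "r_p p n X = Inf {r_p_f p n c | c :: (nat \<Rightarrow> nat) \<Rightarrow> 'a. \<exists>f.
       holo_powser n c f \<and> (\<forall>z\<in>polydisk n. norm (f z) \<le> 1)}"

end

theory Submission
  imports Defs
begin

text \<open>In one variable, convolving \<open>u(\<theta>) = \<Sum>\<^sub>l e\<^bsup>il\<theta>\<^esup> d\<^sub>l\<close> with the probability kernel
  \<open>1 + cos(k\<theta>)\<close> leaves \<open>d\<^sub>0 + e\<^bsup>ik\<theta>\<^esup> d\<^sub>k / 2\<close>, so Jensen's inequality and
  uniform PL-convexity give \<open>\<parallel>d\<^sub>0\<parallel>\<^sup>p + (\<lambda>/2\<^sup>p) \<parallel>d\<^sub>k\<parallel>\<^sup>p \<le> M\<close>, where M is the mean
  of \<open>\<parallel>u\<parallel>\<^sup>p\<close>. Summing a geometric series, \<open>\<Sum>\<^sub>k r\<^bsup>pk\<^esup> \<parallel>d\<^sub>k\<parallel>\<^sup>p \<le> M\<close> whenever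
  \<open>r\<^sup>p \<le> \<lambda>/(2\<^sup>p + \<lambda>)\<close>. The constant on the right being 1, this inequality can be iterated
  over the variables without any loss, which makes the radius independent of n. A bounded
  holomorphic function is reduced to polynomials by shrinking the polydisk slightly, where its
  Taylor series converges absolutely.\<close>

section \<open>Complex scalar multiplication\<close>

lemma bounded_bilinear_scaleC:
  "bounded_bilinear (scaleC :: complex \<Rightarrow> 'a \<Rightarrow> 'a::complex_normed_vector)"
proof
  fix a a' :: complex and b b' :: 'a and r :: real
  show "(a + a') *\<^sub>C b = a *\<^sub>C b + a' *\<^sub>C b" by (rule scaleC_add_left)
  show "a *\<^sub>C (b + b') = a *\<^sub>C b + a *\<^sub>C b'" by (rule scaleC_add_right)
  show "(r *\<^sub>R a) *\<^sub>C b = r *\<^sub>R (a *\<^sub>C b)"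
    by (simp add: scaleR_conv_of_real scaleC_scaleC flip: scaleC_of_real)
  show "a *\<^sub>C (r *\<^sub>R b) = r *\<^sub>R (a *\<^sub>C b)"
    by (simp add: scaleC_scaleC mult.commute flip: scaleC_of_real)
  show "\<exists>K. \<forall>a b. norm (a *\<^sub>C (b::'a)) \<le> norm a * norm b * K"
    by (rule exI[of _ 1]) (simp add: norm_scaleC)
qed

interpretation scaleC: bounded_bilinear
  "scaleC :: complex \<Rightarrow> 'a \<Rightarrow> 'a::complex_normed_vector"
  by (rule bounded_bilinear_scaleC)

section \<open>Means over the circle\<close>

definition circle_mean :: "(real \<Rightarrow> real) \<Rightarrow> real" where
  "circle_mean g = (1 / (2 * pi)) * integral {0..2*pi} g"

lemma circle_mean_mono:
  assumes "continuous_on UNIV g" "continuous_on UNIV h" "\<And>x. g x \<le> h x"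
  shows "circle_mean g \<le> circle_mean h"
  unfolding circle_mean_def
  by (intro mult_left_mono integral_le integrable_continuous_interval)
     (use assms in \<open>auto intro: continuous_on_subset\<close>)

lemma circle_mean_sum:
  assumes "finite J" "\<And>j. j \<in> J \<Longrightarrow> continuous_on UNIV (g j)"
  shows "circle_mean (\<lambda>x. \<Sum>j\<in>J. w j * g j x) = (\<Sum>j\<in>J. w j * circle_mean (g j))"
proof -
  have "integral {0..2*pi} (\<lambda>x. \<Sum>j\<in>J. w j * g j x)
      = (\<Sum>j\<in>J. integral {0..2*pi} (\<lambda>x. w j * g j x))"
    by (intro integral_sum assms integrable_continuous_interval continuous_intros)
       (use assms in \<open>auto intro: continuous_on_subset\<close>)
  then show ?thesis
    unfolding circle_mean_def by (simp add: sum_distrib_left mult.left_commute)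
qed

lemma circle_mean_const [simp]: "circle_mean (\<lambda>x. b) = b"
  by (simp add: circle_mean_def)

text \<open>The shifted window runs from t to T + t; the part that sticks out beyond T is moved back
  to the interval from 0 to t by periodicity.\<close>

lemma integral_periodic_shift:
  fixes g :: "real \<Rightarrow> real"
  assumes cont: "continuous_on UNIV g" and per: "\<And>x. g (x + T) = g x" and t: "0 \<le> t" "t \<le> T"
  shows "integral {0..T} (\<lambda>x. g (x + t)) = integral {0..T} g"
proof -
  have int: "g integrable_on {a..b}" for a b
    by (rule integrable_continuous_interval) (use cont in \<open>auto intro: continuous_on_subset\<close>)
  have "integral {0..T} (\<lambda>x. g (x + t)) = integral {t..T + t} g"
    using integral_shift_real_ivl[where a = t and b = "T + t" and c = t and f = g] by (simp add: o_def)
  also have "\<dots> = integral {t..T} g + integral {T..T + t} g"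
    using t Henstock_Kurzweil_Integration.integral_combine[where a = t and b = "T + t" and c = T and f = g] int by simp
  also have "integral {T..T + t} g = integral {0..t} (\<lambda>x. g (x + T))"
    using integral_shift_real_ivl[where a = T and b = "T + t" and c = T and f = g] by (simp add: o_def)
  also have "\<dots> = integral {0..t} g"
    by (simp add: per)
  also have "integral {t..T} g + integral {0..t} g = integral {0..T} g"
    using Henstock_Kurzweil_Integration.integral_combine[where a = 0 and b = T and c = t and f = g] t int by simp
  finally show ?thesis .
qed

lemma integral_periodic_multiple:
  fixes g :: "real \<Rightarrow> real"
  assumes cont: "continuous_on UNIV g" and per: "\<And>x. g (x + T) = g x" and T: "0 \<le> T"
  shows "integral {0..real m * T} g = real m * integral {0..T} g"
proof (induction m)
  case (Suc m)
  have int: "g integrable_on {a..b}" for a b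
    by (rule integrable_continuous_interval) (use cont in \<open>auto intro: continuous_on_subset\<close>)
  have perm: "g (x + real k * T) = g x" for x k
    by (induction k) (use per in \<open>auto simp: algebra_simps\<close>, metis add.assoc add.commute per)
  have "integral {0..real (Suc m) * T} g
      = integral {0..real m * T} g + integral {real m * T..real (Suc m) * T} g"
    using T Henstock_Kurzweil_Integration.integral_combine[where a = 0 and b = "real (Suc m) * T" and c = "real m * T" and f = g] int by (simp add: mult_right_mono)
  also have "integral {real m * T..real (Suc m) * T} g
      = integral {0..T} (\<lambda>x. g (x + real m * T))"
    using integral_shift_real_ivl[where a = "real m * T" and b = "real (Suc m) * T" and c = "real m * T" and f = g]
    by (simp add: o_def algebra_simps)
  finally show ?case
    unfolding perm Suc by (simp add: algebra_simps)
qed simp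

lemma circle_mean_shift:
  assumes "continuous_on UNIV g" "\<And>x. g (x + 2 * pi) = g x" "0 \<le> t" "t \<le> 2 * pi"
  shows "circle_mean (\<lambda>x. g (x + t)) = circle_mean g"
  using integral_periodic_shift[OF assms] by (simp add: circle_mean_def)

text \<open>The substitution runs through m periods, and the factor 1/m from the change of variable
  cancels this. It later turns a rotation by \<open>cis x\<close> into one by
  \<open>cis (k * x)\<close>.\<close>

lemma circle_mean_dilate:
  assumes cont: "continuous_on UNIV g" and per: "\<And>x. g (x + 2 * pi) = g x" and m: "0 < m"
  shows "circle_mean (\<lambda>x. g (real m * x)) = circle_mean g"
proof -
  have "g integrable_on {0..real m * (2 * pi)}"
    by (rule integrable_continuous_interval) (use cont in \<open>auto intro: continuous_on_subset\<close>)
  then have *: "(g has_integral (real m * integral {0..2*pi} g)) (cbox 0 (real m * (2 * pi)))"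
    using integral_periodic_multiple[OF cont per, of m] by (simp add: has_integral_integral)
  have inv: "inverse (real m) * (real m * c) = c" for c
    using m by simp
  from has_integral_affinity'[OF *, of "real m" 0] m
  have "((\<lambda>x. g (real m * x)) has_integral integral {0..2*pi} g) {0..2*pi}"
    by (simp only: inv box_real diff_zero add_0_right real_scaleR_def DIM_real power_one_right of_nat_0_less_iff
        mult_zero_right scaleR_zero_right)
  then show ?thesis
    by (simp add: circle_mean_def integral_unique)
qed

section \<open>Extracting two coefficients at roots of unity\<close>

text \<open>A geometric sum whose ratio w satisfies w^M = 1: it vanishes unless w = 1.\<close>

lemma sum_cis_roots_of_unity:
  assumes "0 < M"
  shows "(\<Sum>j<M. cis (real a * (2 * pi * real j / real M))) = (if M dvd a then of_nat M else 0)"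
proof -
  define w where "w = cis (2 * pi * real a / real M)"
  have pw: "cis (real a * (2 * pi * real j / real M)) = w ^ j" for j
    unfolding w_def Complex.DeMoivre by (rule arg_cong[where f = cis]) simp
  have w1: "w = 1 \<longleftrightarrow> M dvd a"
    using complex_root_unity_eq_1[of M a] assms
    by (simp add: w_def cis_conv_exp mult_ac)
  have "w ^ M = cis (2 * pi * real a)"
    using assms by (simp add: w_def Complex.DeMoivre)
  also have "\<dots> = 1"
    by (simp add: cis_multiple_2pi)
  finally show ?thesis
    using w1 unfolding pw by (simp add: sum_gp_strict)
qed

text \<open>Sampling at the 2N-th roots of unity makes the convolution with \<open>1 + cos (k t)\<close> a finite
  convex combination of rotations; 2N points suffice to avoid aliasing.\<close>

lemma extract_two_coefficients:
  fixes d :: "nat \<Rightarrow> 'a::complex_normed_vector"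
  assumes k: "1 \<le> k" "k < N" and M: "M = 2 * N"
  defines "t \<equiv> \<lambda>j. 2 * pi * real j / real M"
  shows "d 0 + cis (real k * x) *\<^sub>C ((1/2) *\<^sub>R d k)
     = (\<Sum>j<M. ((1 + cos (real k * t j)) / real M) *\<^sub>R (\<Sum>l<N. cis (real l * (x + t j)) *\<^sub>C d l))"
    and "(\<Sum>j<M. (1 + cos (real k * t j)) / real M) = 1"
proof -
  have M0: "0 < M" using k M by simp
  \<comment> \<open>\<open>W l\<close> is the multiplier that the averaging applies to the
    coefficient of frequency l.\<close>
  define W where "W = (\<lambda>l. \<Sum>j<M. complex_of_real ((1 + cos (real k * t j)) / real M) * cis (real l * t j))"
  \<comment> \<open>At the sample points the frequency -k agrees with M - k, so all frequencies
    become natural numbers and \<open>sum_cis_roots_of_unity\<close> applies.\<close>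
  have cosk: "complex_of_real (cos (real k * t j)) = (cis (real k * t j) + cis (real (M - k) * t j)) / 2" if "j < M" for j
  proof -
    have "cis (real (M - k) * t j) = cis (2 * pi * real j - real k * t j)"
      using M k M0 by (simp add: t_def field_simps of_nat_diff)
    also have "\<dots> = cis (- (real k * t j))"
      by (simp add: cis_multiple_2pi divide_inverse flip: cis_divide)
    finally show ?thesis
      by (simp add: complex_eq_iff)
  qed
  have W: "W l = (if l = 0 then 1 else if l = k then 1/2 else 0)" if l: "l < N" for l
  proof -
    have "W l = (\<Sum>j<M. (cis (real l * t j) + cis (real (l + k) * t j) / 2 + cis (real (l + (M - k)) * t j) / 2) / of_nat M)"
      unfolding W_def
    proof (rule sum.cong[OF refl])
      fix j assume "j \<in> {..<M}"
      then have j: "j < M" by simp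
      have "complex_of_real ((1 + cos (real k * t j)) / real M) * cis (real l * t j)
        = (1 + (cis (real k * t j) + cis (real (M - k) * t j)) / 2) * cis (real l * t j) / of_nat M"
        by (simp add: cosk[OF j])
      also have "\<dots> = (cis (real l * t j) + cis (real (l + k) * t j) / 2 + cis (real (l + (M - k)) * t j) / 2) / of_nat M"
        by (simp only: of_nat_add distrib_right flip: cis_mult) (simp add: field_simps)
      finally show "complex_of_real ((1 + cos (real k * t j)) / real M) * cis (real l * t j)
        = (cis (real l * t j) + cis (real (l + k) * t j) / 2 + cis (real (l + (M - k)) * t j) / 2) / of_nat M" .
    qed
    also have "\<dots> = ((\<Sum>j<M. cis (real l * t j)) + (\<Sum>j<M. cis (real (l + k) * t j)) / 2
        + (\<Sum>j<M. cis (real (l + (M - k)) * t j)) / 2) / of_nat M"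
      by (simp only: sum.distrib flip: sum_divide_distrib)
    also have "(\<Sum>j<M. cis (real l * t j)) = (if l = 0 then of_nat M else 0)"
      unfolding t_def sum_cis_roots_of_unity[OF M0] using l M by (auto dest: dvd_imp_le)
    \<comment> \<open>No aliasing: 0 < l + k < 2 * N = M.\<close>
    also have "(\<Sum>j<M. cis (real (l + k) * t j)) = 0"
      unfolding t_def sum_cis_roots_of_unity[OF M0] using l M k by (auto dest: dvd_imp_le)
    also have "(\<Sum>j<M. cis (real (l + (M - k)) * t j)) = (if l = k then of_nat M else 0)"
    proof -
      have "M dvd l + (M - k) \<longleftrightarrow> l = k"
      proof
        assume "M dvd l + (M - k)"
        then obtain q where q: "l + (M - k) = M * q" by (elim dvdE)
        \<comment> \<open>The frequency lies strictly between 0 and 2 * M, so M is the only multiple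
          it can be.\<close>
        have "0 < M * q" "M * q < M * 2" using q l k M by linarith+
        then have "q = 1" by simp
        then show "l = k" using q k M by simp
      qed (use k M in auto)
      then show ?thesis
        unfolding t_def sum_cis_roots_of_unity[OF M0] by simp
    qed
    finally show ?thesis
      using M0 k by auto
  qed
  have "(\<Sum>j<M. ((1 + cos (real k * t j)) / real M) *\<^sub>R (\<Sum>l<N. cis (real l * (x + t j)) *\<^sub>C d l))
     = (\<Sum>j<M. \<Sum>l<N. (cis (real l * x) * (complex_of_real ((1 + cos (real k * t j)) / real M) * cis (real l * t j))) *\<^sub>C d l)"
    by (simp only: scaleC.sum_right scaleC_scaleC distrib_left mult_ac flip: cis_mult scaleC_of_real)
  also have "\<dots> = (\<Sum>l<N. \<Sum>j<M. (cis (real l * x) * (complex_of_real ((1 + cos (real k * t j)) / real M) * cis (real l * t j))) *\<^sub>C d l)"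
    by (rule sum.swap)
  also have "\<dots> = (\<Sum>l<N. (cis (real l * x) * W l) *\<^sub>C d l)"
    by (simp only: W_def sum_distrib_left scaleC.sum_left)
  also have "\<dots> = (\<Sum>l\<in>{0,k}. (cis (real l * x) * W l) *\<^sub>C d l)"
    by (rule sum.mono_neutral_right) (use k W in \<open>auto simp: scaleC.zero_left\<close>)
  also have "\<dots> = d 0 + (cis (real k * x) * of_real (1/2)) *\<^sub>C d k"
    using k W[of 0] W[of k] by (simp add: scaleC_one del: eq_divide_eq_numeral1)
  also have "\<dots> = d 0 + cis (real k * x) *\<^sub>C ((1/2) *\<^sub>R d k)"
    by (simp only: flip: scaleC_scaleC scaleC_of_real)
  finally show "d 0 + cis (real k * x) *\<^sub>C ((1/2) *\<^sub>R d k)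
     = (\<Sum>j<M. ((1 + cos (real k * t j)) / real M) *\<^sub>R (\<Sum>l<N. cis (real l * (x + t j)) *\<^sub>C d l))" by simp
  \<comment> \<open>The total weight is the multiplier at frequency 0.\<close>
  have "complex_of_real (\<Sum>j<M. (1 + cos (real k * t j)) / real M) = W 0"
    by (simp add: W_def)
  also have "\<dots> = of_real 1" using W[of 0] k by simp
  finally show "(\<Sum>j<M. (1 + cos (real k * t j)) / real M) = 1"
    by (simp only: of_real_eq_iff)
qed

section \<open>Jensen's inequality for powers of the norm\<close>

text \<open>Norms may vanish, so the endpoint 0 is included. There convexity comes down to s^p \<le>
  s for 0 < s < 1; for positive arguments it is \<open>powr_convex\<close>.\<close>

lemma convex_on_powr_nonneg:
  assumes p: "1 \<le> (p::real)"
  shows "convex_on {0..} (\<lambda>x. x powr p)"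
proof (rule convex_onI)
  fix t x y :: real
  assume t: "0 < t" "t < 1" and xy: "x \<in> {0..}" "y \<in> {0..}"
  have le: "(s * z) powr p \<le> s * z powr p" if "0 < s" "s < 1" "0 \<le> z" for s z :: real
  proof -
    have "s powr p \<le> s powr 1" using that p by (intro powr_mono') auto
    then show ?thesis using that by (simp add: powr_mult mult_right_mono)
  qed
  show "((1 - t) *\<^sub>R x + t *\<^sub>R y) powr p \<le> (1 - t) * x powr p + t * y powr p"
  proof (cases "x = 0 \<or> y = 0")
    case True
    then show ?thesis using le[of t y] le[of "1 - t" x] t xy p by auto
  next
    case False
    then show ?thesis
      using convex_onD[OF powr_convex[OF p], of t x y] t xy by auto
  qed
qed auto

lemma powr_norm_convex_combination_le:
  fixes u :: "'b \<Rightarrow> 'a::real_normed_vector"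
  assumes p: "1 \<le> p" and J: "finite J" and w: "\<And>j. j \<in> J \<Longrightarrow> 0 \<le> w j" and w1: "(\<Sum>j\<in>J. w j) = 1"
  shows "norm (\<Sum>j\<in>J. w j *\<^sub>R u j) powr p \<le> (\<Sum>j\<in>J. w j * norm (u j) powr p)"
proof -
  have ne: "J \<noteq> {}" using w1 by auto
  have "norm (\<Sum>j\<in>J. w j *\<^sub>R u j) \<le> (\<Sum>j\<in>J. w j * norm (u j))"
    by (rule order.trans[OF norm_sum]) (use w in \<open>auto intro!: sum_mono\<close>)
  then have "norm (\<Sum>j\<in>J. w j *\<^sub>R u j) powr p \<le> (\<Sum>j\<in>J. w j *\<^sub>R norm (u j)) powr p"
    using p by (intro powr_mono2) auto
  also have "\<dots> \<le> (\<Sum>j\<in>J. w j * norm (u j) powr p)"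
    by (rule convex_on_sum[OF J ne convex_on_powr_nonneg[OF p] w1]) (use w in auto)
  finally show ?thesis .
qed

lemma continuous_on_norm_powr [continuous_intros]:
  assumes "continuous_on S (f :: _ \<Rightarrow> 'a::real_normed_vector)" "0 < p"
  shows "continuous_on S (\<lambda>x. norm (f x) powr p)"
  using assms by (intro continuous_on_powr' continuous_intros) auto

section \<open>Coefficient inequalities in one variable\<close>

lemma PL_ineq_two_coefficients:
  fixes d :: "nat \<Rightarrow> 'a::complex_normed_vector"
  assumes PL: "PL_ineq p lam TYPE('a)" and p: "1 \<le> p" and k: "1 \<le> k" "k < N"
  shows "norm (d 0) powr p + lam / 2 powr p * norm (d k) powr p
      \<le> circle_mean (\<lambda>x. norm (\<Sum>l<N. cis (real l * x) *\<^sub>C d l) powr p)"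
proof -
  define M where "M = 2 * N"
  define t where "t = (\<lambda>j. 2 * pi * real j / real M)"
  define w where "w = (\<lambda>j. (1 + cos (real k * t j)) / real M)"
  define u where "u = (\<lambda>x. \<Sum>l<N. cis (real l * x) *\<^sub>C d l)"
  \<comment> \<open>The half left by the cosine; its p-th power produces the 2^p in the final
    constant.\<close>
  define y where "y = (1/2) *\<^sub>R d k"
  have id: "d 0 + cis (real k * x) *\<^sub>C y = (\<Sum>j<M. w j *\<^sub>R u (x + t j))" for x
    using extract_two_coefficients(1)[OF k M_def] by (simp add: t_def w_def u_def y_def)
  have w1: "(\<Sum>j<M. w j) = 1"
    using extract_two_coefficients(2)[OF k M_def] by (simp add: t_def w_def)
  \<comment> \<open>Positivity of the kernel 1 + cos makes the weights a convex combination, as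
    Jensen's inequality requires.\<close>
  have w0: "0 \<le> w j" for j
    unfolding w_def using cos_ge_minus_one[of "real k * t j"] by (intro divide_nonneg_nonneg) linarith+
  have t: "0 \<le> t j" "t j \<le> 2 * pi" if "j < M" for j
    using that by (auto simp: t_def field_simps)
  have percis: "cis (real l * (x + 2 * pi)) = cis (real l * x)" for l x
    using cis_multiple_2pi[of "real l"] by (simp add: distrib_left mult_ac flip: cis_mult)
  have contu: "continuous_on UNIV (\<lambda>x. norm (u (x + s)) powr p)" for s
    unfolding u_def using p by (intro continuous_intros scaleC.continuous_on) auto
  have conty: "continuous_on UNIV (\<lambda>x. norm (d 0 + cis (a * x) *\<^sub>C y) powr p)" for a
    using p by (intro continuous_intros scaleC.continuous_on) auto
  have "norm (d 0) powr p + lam * norm y powr p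
      \<le> circle_mean (\<lambda>x. norm (d 0 + cis x *\<^sub>C y) powr p)"
    using PL by (simp add: PL_ineq_def circle_mean_def)
  also have "\<dots> = circle_mean (\<lambda>x. norm (d 0 + cis (real k * x) *\<^sub>C y) powr p)"
    by (rule circle_mean_dilate[symmetric])
       (use k conty[of 1] percis[of 1] in \<open>auto\<close>)
  also have "\<dots> \<le> circle_mean (\<lambda>x. \<Sum>j<M. w j * norm (u (x + t j)) powr p)"
    by (intro circle_mean_mono conty continuous_intros contu)
       (auto simp: id intro!: powr_norm_convex_combination_le p w0 w1)
  also have "\<dots> = (\<Sum>j<M. w j * circle_mean (\<lambda>x. norm (u (x + t j)) powr p))"
    by (rule circle_mean_sum) (auto intro: contu)
  \<comment> \<open>All rotates of \<open>u\<close> have the same mean, so the weights, which add up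
    to 1, drop out.\<close>
  also have "\<dots> = (\<Sum>j<M. w j * circle_mean (\<lambda>x. norm (u x) powr p))"
    by (intro sum.cong refl arg_cong2[where f="(*)"] circle_mean_shift)
       (use contu[of 0] t in \<open>auto simp: u_def percis\<close>)
  also have "\<dots> = circle_mean (\<lambda>x. norm (u x) powr p)"
    by (simp add: w1 flip: sum_distrib_right)
  finally show ?thesis
    by (simp add: y_def u_def powr_mult powr_divide)
qed

text \<open>Each coefficient with k >= 1 separately satisfies \<mu> * |d_k|^p \<le> B. Weighting
  these bounds by q^k costs at most q / (1 - q), which is at most \<mu> exactly when q \<le> \<mu> /
  (1 + \<mu>) = lam / (2^p + lam). This is the origin of the radius.\<close>

lemma PL_ineq_weighted_coefficient_sum:
  fixes d :: "nat \<Rightarrow> 'a::complex_normed_vector"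
  assumes PL: "PL_ineq p lam TYPE('a)" and lam: "0 < lam" and p: "1 \<le> p"
    and r: "0 < r" "r powr p \<le> lam / (2 powr p + lam)" and N: "2 \<le> N"
  shows "(\<Sum>k<N. norm (r ^ k *\<^sub>R d k) powr p)
      \<le> circle_mean (\<lambda>x. norm (\<Sum>l<N. cis (real l * x) *\<^sub>C d l) powr p)"
proof -
  define A where "A = circle_mean (\<lambda>x. norm (\<Sum>l<N. cis (real l * x) *\<^sub>C d l) powr p)"
  define \<mu> where "\<mu> = lam / 2 powr p"
  define q where "q = r powr p"
  define B where "B = A - norm (d 0) powr p"
  have \<mu>: "0 < \<mu>" using lam by (simp add: \<mu>_def)
  have q0: "0 < q" using r by (simp add: q_def)
  have "q * (2 powr p + lam) \<le> lam"
    using r lam by (simp add: q_def field_simps add_pos_pos)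
  then have "q * (2 powr p + lam) / 2 powr p \<le> lam / 2 powr p"
    by (rule divide_right_mono) simp
  then have "q * (1 + \<mu>) \<le> \<mu>"
    by (simp add: \<mu>_def distrib_left add_divide_distrib)
  then have q\<mu>: "q \<le> \<mu> * (1 - q)" by (simp add: algebra_simps)
  then have q1: "q < 1" using q0 \<mu> by (smt (verit) zero_less_mult_pos)
  have coeff: "\<mu> * norm (d k) powr p \<le> B" if "1 \<le> k" "k < N" for k
    using PL_ineq_two_coefficients[OF PL p that, of d] by (simp add: A_def B_def \<mu>_def)
  \<comment> \<open>The index 1 is available because 2 \<le> N.\<close>
  have B0: "0 \<le> B"
    using coeff[of 1] N \<mu> powr_ge_zero[of "norm (d 1)" p] mult_nonneg_nonneg[of \<mu> "norm (d 1) powr p"] by linarith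
  have weight: "norm (r ^ k *\<^sub>R d k) powr p = q ^ k * norm (d k) powr p" for k
    using r by (simp add: q_def powr_mult powr_power powr_powr flip: powr_realpow) (simp add: mult.commute)
  have geom: "(\<Sum>k=1..<N. q ^ k) \<le> \<mu>"
  proof -
    have "(\<Sum>k=1..<N. q ^ k) * (1 - q) = q - q ^ N"
      using sum_gp_multiplied[of 1 "N - 1" q] N by (cases N) (auto simp: atLeastLessThanSuc_atLeastAtMost mult.commute)
    also have "\<dots> \<le> \<mu> * (1 - q)" using q\<mu> q0 by (smt (verit) zero_less_power)
    finally show ?thesis using q1 by simp
  qed
  have "\<mu> * (\<Sum>k=1..<N. q ^ k * norm (d k) powr p) = (\<Sum>k=1..<N. q ^ k * (\<mu> * norm (d k) powr p))"
    by (simp add: sum_distrib_left mult_ac)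
  also have "\<dots> \<le> (\<Sum>k=1..<N. q ^ k * B)"
    using coeff q0 by (intro sum_mono mult_left_mono) auto
  also have "\<dots> \<le> \<mu> * B"
    using geom B0 by (simp add: mult_right_mono flip: sum_distrib_right)
  finally have "(\<Sum>k=1..<N. q ^ k * norm (d k) powr p) \<le> B"
    using \<mu> by simp
  moreover have "(\<Sum>k<N. q ^ k * norm (d k) powr p)
      = norm (d 0) powr p + (\<Sum>k=1..<N. q ^ k * norm (d k) powr p)"
    using N by (simp add: lessThan_atLeast0 sum.atLeast_Suc_lessThan)
  ultimately show ?thesis
    by (simp only: weight A_def B_def)
qed

section \<open>Finite boxes of multi-indices\<close>

text \<open>Truncating each exponent separately, rather than the total degree, gives a product set,
  so sums split off the last variable.\<close>

definition index_box :: "nat \<Rightarrow> nat \<Rightarrow> (nat \<Rightarrow> nat) set" where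
  "index_box N n = {\<alpha>. (\<forall>i<n. \<alpha> i < N) \<and> (\<forall>i\<ge>n. \<alpha> i = 0)}"

lemma index_box_0 [simp]: "index_box N 0 = {\<lambda>_. 0}"
  by (auto simp: index_box_def)

lemma bij_betw_index_box_Suc:
  "bij_betw (\<lambda>(k, \<alpha>). \<alpha>(n := k)) ({..<N} \<times> index_box N n) (index_box N (Suc n))"
  by (rule bij_betw_byWitness[where f' = "\<lambda>\<alpha>. (\<alpha> n, \<alpha>(n := 0))"])
     (auto simp: index_box_def fun_eq_iff less_Suc_eq)

lemma finite_index_box [simp]: "finite (index_box N n)"
  by (induction n) (simp_all add: bij_betw_finite[OF bij_betw_index_box_Suc, symmetric])

lemma sum_index_box_Suc:
  "(\<Sum>\<alpha>\<in>index_box N (Suc n). g \<alpha>) = (\<Sum>k<N. \<Sum>\<alpha>\<in>index_box N n. g (\<alpha>(n := k)))"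
  by (simp add: sum.reindex_bij_betw[OF bij_betw_index_box_Suc, symmetric] sum.cartesian_product
      case_prod_unfold)

lemma sum_index_box_prod_power:
  "(\<Sum>\<alpha>\<in>index_box N n. \<Prod>i<n. t ^ \<alpha> i) = (\<Sum>k<N. t ^ k :: real) ^ n"
proof (induction n)
  case (Suc n)
  have "(\<Sum>\<alpha>\<in>index_box N (Suc n). \<Prod>i<Suc n. t ^ \<alpha> i)
      = (\<Sum>k<N. \<Sum>\<alpha>\<in>index_box N n. (\<Prod>i<n. t ^ \<alpha> i) * t ^ k)"
    by (simp add: sum_index_box_Suc)
  then show ?case
    by (simp add: Suc mult.commute flip: sum_distrib_left sum_distrib_right)
qed simp

lemma index_box_subset_multi_indices: "index_box N n \<subseteq> multi_indices n"
  by (auto simp: index_box_def multi_indices_def)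

lemma finite_multi_indices_subset_index_box:
  assumes "finite F" "F \<subseteq> multi_indices n"
  obtains N where "2 \<le> N" "F \<subseteq> index_box N n"
proof
  \<comment> \<open>The sum of all exponents dominates each of them; adding 2 gives strictness and
    the lower bound on \<open>N\<close>.\<close>
  define N where "N = 2 + (\<Sum>\<alpha>\<in>F. \<Sum>i<n. \<alpha> i)"
  show "2 \<le> N" by (simp add: N_def)
  show "F \<subseteq> index_box N n"
  proof
    fix \<alpha> assume \<alpha>: "\<alpha> \<in> F"
    have "\<alpha> i < N" if "i < n" for i
    proof -
      have "\<alpha> i \<le> (\<Sum>i<n. \<alpha> i)" using that by (intro member_le_sum) auto
      also have "\<dots> \<le> (\<Sum>\<alpha>\<in>F. \<Sum>i<n. \<alpha> i)"
        using \<alpha> assms(1) by (intro member_le_sum[where f = "\<lambda>\<alpha>. \<Sum>i<n. \<alpha> i"]) auto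
      finally show ?thesis by (simp add: N_def)
    qed
    then show "\<alpha> \<in> index_box N n"
      using \<alpha> assms(2) by (auto simp: index_box_def multi_indices_def)
  qed
qed

section \<open>Polynomials in several variables\<close>

lemma mono_pow_Suc_upd: "mono_pow (Suc n) (z(n := v)) (\<alpha>(n := k)) = v ^ k * mono_pow n z \<alpha>"
  by (simp add: mono_pow_def mult.commute)

text \<open>Treating one variable at a time turns a single function into the family of its coefficients
  in that variable, so the induction needs finite families; their members are labelled by the
  lists of exponents already split off.\<close>

lemma PL_ineq_polynomial_coefficients:
  fixes C :: "nat list \<Rightarrow> (nat \<Rightarrow> nat) \<Rightarrow> 'a::complex_normed_vector"
  assumes PL: "PL_ineq p lam TYPE('a)" and lam: "0 < lam" and p: "1 \<le> p"
    and r: "0 < r" "r powr p \<le> lam / (2 powr p + lam)" and N: "2 \<le> N"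
    and "finite J"
    and "\<And>z. (\<And>i. cmod (z i) = 1) \<Longrightarrow>
      (\<Sum>j\<in>J. norm (\<Sum>\<alpha>\<in>index_box N n. mono_pow n z \<alpha> *\<^sub>C C j \<alpha>) powr p) \<le> B"
  shows "(\<Sum>j\<in>J. \<Sum>\<alpha>\<in>index_box N n. norm ((\<Prod>i<n. r ^ \<alpha> i) *\<^sub>R C j \<alpha>) powr p) \<le> B"
  using assms(7,8)
proof (induction n arbitrary: J C)
  case 0
  then show ?case
    using 0(2)[of "\<lambda>_. 1"] by (simp add: mono_pow_def scaleC_one)
next
  case (Suc n)
  \<comment> \<open>The exponent of the last variable is prepended to the label. Its weight r^k is
    absorbed into the coefficient \<open>C'\<close>, so that the induction hypothesis returns the
    full product of weights.\<close>
  define J' where "J' = (\<lambda>(k, j). k # j) ` ({..<N} \<times> J)"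
  define C' where "C' = (\<lambda>l \<alpha>. r ^ hd l *\<^sub>R C (tl l) (\<alpha>(n := hd l)))"
  have sumJ': "(\<Sum>l\<in>J'. g l) = (\<Sum>j\<in>J. \<Sum>k<N. g (k # j))" for g :: "nat list \<Rightarrow> real"
  proof -
    have "(\<Sum>l\<in>J'. g l) = (\<Sum>(k, j)\<in>{..<N} \<times> J. g (k # j))"
      unfolding J'_def by (subst sum.reindex) (auto simp: inj_on_def case_prod_unfold)
    also have "\<dots> = (\<Sum>k<N. \<Sum>j\<in>J. g (k # j))"
      by (simp add: sum.cartesian_product)
    finally show ?thesis
      by (simp only: sum.swap[of _ J])
  qed
  have "(\<Sum>l\<in>J'. \<Sum>\<alpha>\<in>index_box N n. norm ((\<Prod>i<n. r ^ \<alpha> i) *\<^sub>R C' l \<alpha>) powr p) \<le> B"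
  proof (rule Suc.IH)
    show "finite J'" using Suc.prems(1) by (simp add: J'_def)
    fix z :: "nat \<Rightarrow> complex"
    assume z: "\<And>i. cmod (z i) = 1"
    \<comment> \<open>With the first n variables frozen at z, \<open>d j k\<close> is the k-th
      coefficient in the last variable of the polynomial labelled j.\<close>
    define d where "d = (\<lambda>j k. \<Sum>\<alpha>\<in>index_box N n. mono_pow n z \<alpha> *\<^sub>C C j (\<alpha>(n := k)))"
    have poly: "(\<Sum>\<alpha>\<in>index_box N (Suc n). mono_pow (Suc n) (z(n := cis x)) \<alpha> *\<^sub>C C j \<alpha>)
        = (\<Sum>k<N. cis (real k * x) *\<^sub>C d j k)" for j x
      by (simp add: sum_index_box_Suc mono_pow_Suc_upd d_def scaleC.sum_right scaleC_scaleC
          Complex.DeMoivre)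
    have cont: "continuous_on UNIV (\<lambda>x. norm (\<Sum>k<N. cis (real k * x) *\<^sub>C d j k) powr p)" for j
      using p by (intro continuous_intros scaleC.continuous_on) auto
    have "(\<Sum>l\<in>J'. norm (\<Sum>\<alpha>\<in>index_box N n. mono_pow n z \<alpha> *\<^sub>C C' l \<alpha>) powr p)
        = (\<Sum>j\<in>J. \<Sum>k<N. norm (r ^ k *\<^sub>R d j k) powr p)"
      by (simp only: sumJ' C'_def d_def list.sel scaleC.scaleR_right scaleR_sum_right)
    \<comment> \<open>The factor 1 puts the sum into the weighted form of
      \<open>circle_mean_sum\<close>.\<close>
    also have "\<dots> \<le> (\<Sum>j\<in>J. 1 * circle_mean (\<lambda>x. norm (\<Sum>k<N. cis (real k * x) *\<^sub>C d j k) powr p))"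
      unfolding mult_1 by (intro sum_mono PL_ineq_weighted_coefficient_sum[OF PL lam p r N])
    also have "\<dots> = circle_mean (\<lambda>x. \<Sum>j\<in>J. 1 * norm (\<Sum>k<N. cis (real k * x) *\<^sub>C d j k) powr p)"
      by (rule circle_mean_sum[symmetric]) (use Suc.prems(1) cont in auto)
    also have "\<dots> \<le> circle_mean (\<lambda>x. B)"
    proof (rule circle_mean_mono)
      fix x :: real
      show "(\<Sum>j\<in>J. 1 * norm (\<Sum>k<N. cis (real k * x) *\<^sub>C d j k) powr p) \<le> B"
      proof -
        \<comment> \<open>Replacing the last variable by \<open>cis x\<close> stays on the torus, so
          the hypothesis bounds the integrand pointwise.\<close>
        have "cmod ((z(n := cis x)) i) = 1" for i using z by simp
        from Suc.prems(2)[of "z(n := cis x)", OF this] show ?thesis by (simp only: poly mult_1)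
      qed
    qed (auto intro!: continuous_intros cont)
    finally show "(\<Sum>l\<in>J'. norm (\<Sum>\<alpha>\<in>index_box N n. mono_pow n z \<alpha> *\<^sub>C C' l \<alpha>) powr p) \<le> B"
      by simp
  qed
  then show ?case
    by (simp add: sumJ' C'_def sum_index_box_Suc)
qed

section \<open>From polynomials to bounded power series\<close>

text \<open>Outside a suitable finite set every term is the difference of two partial sums within 1
  of s, hence of norm below 2; the finitely many other terms are bounded by the sum of their
  norms.\<close>

lemma has_sum_bounded_terms:
  fixes f :: "'b \<Rightarrow> 'a::real_normed_vector"
  assumes "(f has_sum s) A"
  obtains K where "0 < K" "\<And>a. a \<in> A \<Longrightarrow> norm (f a) \<le> K"
proof -
  have "eventually (\<lambda>F. dist (sum f F) s < 1) (finite_subsets_at_top A)"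
    using assms by (auto simp: has_sum_def tendsto_iff)
  then obtain F where F: "finite F" "F \<subseteq> A"
    and close: "\<And>G. finite G \<Longrightarrow> F \<subseteq> G \<Longrightarrow> G \<subseteq> A \<Longrightarrow> dist (sum f G) s < 1"
    by (auto simp: eventually_finite_subsets_at_top)
  have "norm (f a) \<le> 2 + (\<Sum>b\<in>F. norm (f b))" if a: "a \<in> A" for a
  proof (cases "a \<in> F")
    case True
    then have "norm (f a) \<le> (\<Sum>b\<in>F. norm (f b))"
      using F by (intro member_le_sum[where f = "\<lambda>b. norm (f b)"]) auto
    then show ?thesis by simp
  next
    case False
    have "dist (sum f (insert a F)) (sum f F) < 2"
      using close[of "insert a F"] close[of F] F a
        dist_triangle2[of "sum f (insert a F)" "sum f F" s] by (auto simp: subset_insertI)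
    then have "norm (f a) < 2"
      using F False by (simp add: dist_norm)
    then show ?thesis
      using sum_nonneg[of F "\<lambda>b. norm (f b)"] by simp
  qed
  then show ?thesis
    using sum_nonneg[of F "\<lambda>b. norm (f b)"] by (intro that[of "2 + (\<Sum>b\<in>F. norm (f b))"]) auto
qed

lemma mono_pow_of_real_scale:
  "mono_pow n (\<lambda>i. if i < n then complex_of_real t * z i else 0) \<alpha>
     = of_real (\<Prod>i<n. t ^ \<alpha> i) * mono_pow n z \<alpha>"
  by (simp add: mono_pow_def power_mult_distrib prod.distrib)

text \<open>Abel's argument: the terms are bounded at an intermediate radius \<sigma>, so at radius
  \<rho> they are dominated by a product of geometric series of ratio \<rho> / \<sigma>.\<close>

lemma holo_powser_abs_summable:
  fixes c :: "(nat \<Rightarrow> nat) \<Rightarrow> 'a::complex_normed_vector"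
  assumes holo: "holo_powser n c f" and \<rho>: "0 \<le> \<rho>" "\<rho> < 1"
  shows "(\<lambda>\<alpha>. (\<Prod>i<n. \<rho> ^ \<alpha> i) * norm (c \<alpha>)) summable_on multi_indices n"
proof -
  \<comment> \<open>The midpoint of \<rho> and 1 is positive even if \<rho> = 0, so the ratio makes
    sense.\<close>
  define \<sigma> where "\<sigma> = (1 + \<rho>) / 2"
  define t where "t = \<rho> / \<sigma>"
  have \<sigma>: "0 < \<sigma>" "\<sigma> < 1" and t: "0 \<le> t" "t < 1" and t\<sigma>: "\<rho> = t * \<sigma>"
    using \<rho> by (auto simp: \<sigma>_def t_def field_simps)
  \<comment> \<open>The factor 1 matches the form of \<open>mono_pow_of_real_scale\<close>.\<close>
  define z where "z = (\<lambda>i. if i < n then complex_of_real \<sigma> * 1 else 0)"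
  have "z \<in> polydisk n" using \<sigma> by (auto simp: polydisk_def z_def)
  with holo have "((\<lambda>\<alpha>. mono_pow n z \<alpha> *\<^sub>C c \<alpha>) has_sum f z) (multi_indices n)"
    by (auto simp: holo_powser_def)
  from has_sum_bounded_terms[OF this] obtain K where K: "0 < K"
    "\<And>\<alpha>. \<alpha> \<in> multi_indices n \<Longrightarrow> norm (mono_pow n z \<alpha> *\<^sub>C c \<alpha>) \<le> K" by blast
  have norm_z: "norm (mono_pow n z \<alpha> *\<^sub>C c \<alpha>) = (\<Prod>i<n. \<sigma> ^ \<alpha> i) * norm (c \<alpha>)" for \<alpha>
    unfolding z_def mono_pow_of_real_scale[where z = "\<lambda>_. 1"] norm_scaleC
    using \<sigma> by (simp add: mono_pow_def norm_mult abs_of_nonneg prod_nonneg del: of_real_prod)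
  have le: "(\<Prod>i<n. \<rho> ^ \<alpha> i) * norm (c \<alpha>) \<le> K * (\<Prod>i<n. t ^ \<alpha> i)" if "\<alpha> \<in> multi_indices n" for \<alpha>
  proof -
    have "(\<Prod>i<n. t ^ \<alpha> i) * ((\<Prod>i<n. \<sigma> ^ \<alpha> i) * norm (c \<alpha>)) \<le> (\<Prod>i<n. t ^ \<alpha> i) * K"
      using K(2)[OF that] t by (intro mult_left_mono prod_nonneg) (auto simp: norm_z)
    then show ?thesis
      by (simp add: t\<sigma> power_mult_distrib prod.distrib mult_ac)
  qed
  show ?thesis
  proof (rule nonneg_bdd_above_summable_on)
    show "bdd_above (sum (\<lambda>\<alpha>. (\<Prod>i<n. \<rho> ^ \<alpha> i) * norm (c \<alpha>)) ` {F. F \<subseteq> multi_indices n \<and> finite F})"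
    proof (rule bdd_aboveI2)
      fix F assume "F \<in> {F. F \<subseteq> multi_indices n \<and> finite F}"
      then have F: "F \<subseteq> multi_indices n" "finite F" by auto
      obtain N where N: "2 \<le> N" "F \<subseteq> index_box N n"
        using finite_multi_indices_subset_index_box[OF F(2,1)] .
      have "(\<Sum>\<alpha>\<in>F. (\<Prod>i<n. \<rho> ^ \<alpha> i) * norm (c \<alpha>)) \<le> (\<Sum>\<alpha>\<in>F. K * (\<Prod>i<n. t ^ \<alpha> i))"
        using F le by (intro sum_mono) auto
      also have "\<dots> \<le> (\<Sum>\<alpha>\<in>index_box N n. K * (\<Prod>i<n. t ^ \<alpha> i))"
        using N t K by (intro sum_mono2) (auto intro!: mult_nonneg_nonneg prod_nonneg)
      also have "\<dots> = K * (\<Sum>k<N. t ^ k) ^ n"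
        by (simp add: sum_index_box_prod_power flip: sum_distrib_left)
      also have "\<dots> \<le> K * (1 / (1 - t)) ^ n"
      proof (intro mult_left_mono power_mono)
        show "(\<Sum>k<N. t ^ k) \<le> 1 / (1 - t)"
          using t by (simp add: sum_gp_strict divide_right_mono)
      qed (use K t in \<open>auto intro: sum_nonneg\<close>)
      finally show "(\<Sum>\<alpha>\<in>F. (\<Prod>i<n. \<rho> ^ \<alpha> i) * norm (c \<alpha>)) \<le> K * (1 / (1 - t)) ^ n" .
    qed
  qed (use \<rho> in \<open>auto intro!: mult_nonneg_nonneg prod_nonneg\<close>)
qed

text \<open>Dilation by \<rho> moves the unit torus into the open polydisk, where the series
  converges absolutely. A large partial sum is then a polynomial of norm at most 1 + e on the torus;
  the polynomial inequality applies to it, and e tends to 0.\<close>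

lemma bounded_holo_powser_coefficients:
  fixes c :: "(nat \<Rightarrow> nat) \<Rightarrow> 'a::{complex_normed_vector,banach}"
  assumes PL: "PL_ineq p lam TYPE('a)" and lam: "0 < lam" and p: "1 \<le> p"
    and r: "0 < r" "r powr p \<le> lam / (2 powr p + lam)"
    and holo: "holo_powser n c f" and bound: "\<And>z. z \<in> polydisk n \<Longrightarrow> norm (f z) \<le> 1"
    and \<rho>: "0 \<le> \<rho>" "\<rho> < 1" and F: "finite F" "F \<subseteq> multi_indices n"
  shows "(\<Sum>\<alpha>\<in>F. norm ((\<Prod>i<n. (\<rho> * r) ^ \<alpha> i) *\<^sub>R c \<alpha>) powr p) \<le> 1"
proof -
  define S where "S = (\<Sum>\<alpha>\<in>F. norm ((\<Prod>i<n. (\<rho> * r) ^ \<alpha> i) *\<^sub>R c \<alpha>) powr p)"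
  define g where "g = (\<lambda>\<alpha>. (\<Prod>i<n. \<rho> ^ \<alpha> i) * norm (c \<alpha>))"
  have g: "g summable_on multi_indices n"
    unfolding g_def by (rule holo_powser_abs_summable[OF holo \<rho>])
  have "S \<le> (1 + e) powr p" if e: "0 < e" for e
  proof -
    have "eventually (\<lambda>G. dist (sum g G) (infsum g (multi_indices n)) < e)
        (finite_subsets_at_top (multi_indices n))"
      using has_sum_infsum[OF g] e by (auto simp: has_sum_def tendsto_iff)
    then obtain G where G: "finite G" "G \<subseteq> multi_indices n"
      and close: "\<And>H. finite H \<Longrightarrow> G \<subseteq> H \<Longrightarrow> H \<subseteq> multi_indices n \<Longrightarrow>
        dist (sum g H) (infsum g (multi_indices n)) < e"
      by (auto simp: eventually_finite_subsets_at_top)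
    \<comment> \<open>The box has to contain \<open>F\<close>, whose sum is to be estimated, and
      \<open>G\<close>, beyond which the tail is smaller than e.\<close>
    obtain N where N: "2 \<le> N" "F \<union> G \<subseteq> index_box N n"
      using finite_multi_indices_subset_index_box[of "F \<union> G" n] F G by auto
    define T where "T = multi_indices n - index_box N n"
    have "infsum g T = infsum g (multi_indices n) - sum g (index_box N n)"
      unfolding T_def using g index_box_subset_multi_indices by (subst infsum_Diff) auto
    then have tail: "infsum g T < e"
      using close[of "index_box N n"] N index_box_subset_multi_indices[of N n]
      by (auto simp: dist_real_def)
    have gT: "g summable_on T"
      using g by (rule summable_on_subset_banach) (auto simp: T_def)
    define a where "a = (\<lambda>\<alpha>. (\<Prod>i<n. \<rho> ^ \<alpha> i) *\<^sub>R c \<alpha>)"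
    have "norm (\<Sum>\<alpha>\<in>index_box N n. mono_pow n w \<alpha> *\<^sub>C a \<alpha>) \<le> 1 + e"
      if w: "\<And>i. cmod (w i) = 1" for w
    proof -
      define z where "z = (\<lambda>i. if i < n then complex_of_real \<rho> * w i else 0)"
      have z: "z \<in> polydisk n" using \<rho> w by (auto simp: polydisk_def z_def norm_mult)
      define h where "h = (\<lambda>\<alpha>. mono_pow n z \<alpha> *\<^sub>C c \<alpha>)"
      have h: "h \<alpha> = mono_pow n w \<alpha> *\<^sub>C a \<alpha>" for \<alpha>
        unfolding h_def a_def z_def mono_pow_of_real_scale
        by (simp only: scaleC_scaleC mult.commute flip: scaleC_of_real)
      have "cmod (mono_pow n w \<alpha>) = 1" for \<alpha>
        by (simp add: mono_pow_def norm_power w flip: prod_norm)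
      then have norm_h: "norm (h \<alpha>) = g \<alpha>" for \<alpha>
        using \<rho> by (simp add: h a_def g_def norm_scaleC prod_nonneg)
      have hs: "(h has_sum f z) (multi_indices n)"
        using holo z by (auto simp: holo_powser_def h_def)
      then have "infsum h T = f z - sum h (index_box N n)"
        unfolding T_def using index_box_subset_multi_indices
        by (subst infsum_Diff) (auto simp: has_sum_imp_summable infsumI)
      \<comment> \<open>The partial sum is the value of f minus the tail.\<close>
      then have "norm (sum h (index_box N n)) \<le> norm (f z) + norm (infsum h T)"
        by (metis add_diff_cancel_left' diff_add_cancel norm_triangle_ineq4)
      also have "norm (infsum h T) \<le> infsum (\<lambda>\<alpha>. norm (h \<alpha>)) T"
        by (rule norm_infsum_bound) (simp add: norm_h gT)
      finally show ?thesis
        using bound[OF z] tail by (simp add: norm_h h[symmetric])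
    qed
    \<comment> \<open>A single polynomial is the family labelled by the empty list: no exponent has
      been split off yet.\<close>
    then have "(\<Sum>j\<in>{[]::nat list}. \<Sum>\<alpha>\<in>index_box N n. norm ((\<Prod>i<n. r ^ \<alpha> i) *\<^sub>R a \<alpha>) powr p)
        \<le> (1 + e) powr p"
      using p by (intro PL_ineq_polynomial_coefficients[OF PL lam p r N(1)]) (auto intro!: powr_mono2)
    moreover have "S \<le> (\<Sum>\<alpha>\<in>index_box N n. norm ((\<Prod>i<n. (\<rho> * r) ^ \<alpha> i) *\<^sub>R c \<alpha>) powr p)"
      unfolding S_def using N by (intro sum_mono2) auto
    ultimately show ?thesis
      by (simp add: a_def power_mult_distrib prod.distrib mult.commute)
  qed
  then have "eventually (\<lambda>e. S \<le> (1 + e) powr p) (at_right 0)"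
    by (auto simp: eventually_at_right_field intro!: exI[of _ 1])
  moreover have "((\<lambda>e. (1 + e) powr p) \<longlongrightarrow> (1 + 0) powr p) (at_right 0)"
    by (intro tendsto_intros) auto
  ultimately show ?thesis
    unfolding S_def by (simp add: tendsto_lowerbound)
qed

section \<open>The Bohr condition at the claimed radius\<close>

text \<open>A fixed z has finitely many coordinates, each of modulus below r, so a single \<rho> < 1
  gives the bound \<rho> * r for all of them. It then suffices to bound finite partial sums.\<close>

lemma bohr_cond_of_bounded_holo_powser:
  fixes c :: "(nat \<Rightarrow> nat) \<Rightarrow> 'a::{complex_normed_vector,banach}"
  assumes PL: "PL_ineq p lam TYPE('a)" and lam: "0 < lam" and p: "1 \<le> p"
    and r: "0 < r" "r powr p \<le> lam / (2 powr p + lam)"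
    and holo: "holo_powser n c f" and bound: "\<And>z. z \<in> polydisk n \<Longrightarrow> norm (f z) \<le> 1"
  shows "bohr_cond p n c r"
  unfolding bohr_cond_def
proof (intro allI impI, elim conjE)
  fix z :: "nat \<Rightarrow> complex"
  assume z: "\<forall>i<n. cmod (z i) < r" and "\<forall>i\<ge>n. z i = 0"
  \<comment> \<open>The inserted 0 keeps the set nonempty for n = 0 and makes \<rho>
    nonnegative.\<close>
  define \<rho> where "\<rho> = Max (insert 0 ((\<lambda>i. cmod (z i) / r) ` {..<n}))"
  have \<rho>: "0 \<le> \<rho>" "\<rho> < 1"
    using z r by (auto simp: \<rho>_def)
  have z_le: "cmod (z i) \<le> \<rho> * r" if "i < n" for i
  proof -
    have "cmod (z i) / r \<le> \<rho>"
      unfolding \<rho>_def using that by (intro Max_ge) auto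
    then show ?thesis using r by (simp add: divide_le_eq)
  qed
  define h where "h = (\<lambda>\<alpha>. ennreal (norm (mono_pow n z \<alpha> *\<^sub>C c \<alpha>) powr p))"
  have summ: "h summable_on A" for A
    by (rule nonneg_summable_on_complete) auto
  have "infsum h (multi_indices n) \<le> 1"
  proof (rule infsum_le_finite_sums[OF summ])
    fix F assume F: "finite F" "F \<subseteq> multi_indices n"
    have "(\<Sum>\<alpha>\<in>F. norm (mono_pow n z \<alpha> *\<^sub>C c \<alpha>) powr p)
        \<le> (\<Sum>\<alpha>\<in>F. norm ((\<Prod>i<n. (\<rho> * r) ^ \<alpha> i) *\<^sub>R c \<alpha>) powr p)"
    proof (intro sum_mono powr_mono2)
      fix \<alpha>
      have "cmod (mono_pow n z \<alpha>) \<le> (\<Prod>i<n. (\<rho> * r) ^ \<alpha> i)"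
        unfolding mono_pow_def prod_norm[symmetric] norm_power
        using z_le by (intro prod_mono) (auto intro: power_mono)
      then show "norm (mono_pow n z \<alpha> *\<^sub>C c \<alpha>) \<le> norm ((\<Prod>i<n. (\<rho> * r) ^ \<alpha> i) *\<^sub>R c \<alpha>)"
        unfolding norm_scaleC norm_scaleR by (intro mult_right_mono) auto
    qed (use p in auto)
    also have "\<dots> \<le> 1"
      by (rule bounded_holo_powser_coefficients[OF PL lam p r holo bound \<rho> F])
    finally show "sum h F \<le> 1"
      by (simp add: h_def sum_ennreal)
  qed
  moreover have "infsum h (multi_indices n) = h (\<lambda>_. 0) + infsum h (multi_indices n - {\<lambda>_. 0})"
    by (subst infsum_insert[symmetric, OF summ])
       (auto simp: multi_indices_def insert_absorb)
  ultimately show "ennreal (norm (c (\<lambda>_. 0)) powr p)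
      + (\<Sum>\<^sub>\<infinity>\<alpha>\<in>multi_indices n - {\<lambda>_. 0}. ennreal (norm (mono_pow n z \<alpha> *\<^sub>C c \<alpha>) powr p)) \<le> 1"
    by (simp add: h_def mono_pow_def scaleC_one)
qed

section \<open>The optimal convexity constant\<close>

text \<open>For x = 0 the integrand is the constant |y|^p. The bound makes \<open>I_p\<close> a
  genuine supremum.\<close>

lemma PL_ineq_le_1:
  assumes PL: "PL_ineq p lam TYPE('a::complex_normed_vector)" and p: "0 < p" and y: "(y::'a) \<noteq> 0"
  shows "lam \<le> 1"
proof -
  have "norm (0::'a) powr p + lam * norm y powr p
      \<le> (1 / (2 * pi)) * integral {0..2*pi} (\<lambda>\<theta>. norm (0 + cis \<theta> *\<^sub>C y) powr p)"
    using PL unfolding PL_ineq_def by blast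
  then show ?thesis
    using y by (simp add: norm_scaleC)
qed

text \<open>The supremum is itself admissible: for fixed vectors the inequality is a non-strict
  linear condition on lam, so it survives the passage to the supremum.\<close>

lemma PL_ineq_I_p:
  assumes "p_unif_PL_convex p TYPE('a::complex_normed_vector)" "0 < p" "(y::'a) \<noteq> 0"
  shows "0 < I_p p TYPE('a)" "PL_ineq p (I_p p TYPE('a)) TYPE('a)"
proof -
  define L where "L = {lam. lam > 0 \<and> PL_ineq p lam TYPE('a)}"
  obtain l where l: "l \<in> L"
    using assms(1) by (auto simp: L_def p_unif_PL_convex_def)
  have bdd: "bdd_above L"
    using PL_ineq_le_1[OF _ assms(2,3)] by (intro bdd_aboveI[of _ 1]) (auto simp: L_def)
  have I: "I_p p TYPE('a) = Sup L" by (simp add: I_p_def L_def)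
  show pos: "0 < I_p p TYPE('a)"
    using cSup_upper[OF l bdd] l by (simp add: I L_def)
  show "PL_ineq p (I_p p TYPE('a)) TYPE('a)"
    unfolding PL_ineq_def
  proof (intro allI)
    fix x v :: 'a
    define A where "A = (1 / (2 * pi)) * integral {0..2*pi} (\<lambda>\<theta>. norm (x + cis \<theta> *\<^sub>C v) powr p)"
    have le: "norm x powr p + lam * norm v powr p \<le> A" if "lam \<in> L" for lam
      using that by (auto simp: L_def PL_ineq_def A_def)
    have "norm x powr p + Sup L * norm v powr p \<le> A"
    proof (cases "v = 0")
      case True
      then show ?thesis using le[OF l] by simp
    next
      case False
      then have "Sup L \<le> (A - norm x powr p) / norm v powr p"
        using l le by (intro cSup_least) (auto simp: le_divide_eq algebra_simps)
      then show ?thesis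
        using False by (simp add: le_divide_eq algebra_simps)
    qed
    then show "norm x powr p + I_p p TYPE('a) * norm v powr p
        \<le> (1 / (2 * pi)) * integral {0..2*pi} (\<lambda>\<theta>. norm (x + cis \<theta> *\<^sub>C v) powr p)"
      by (simp add: I A_def)
  qed
qed

section \<open>The upper bound\<close>

text \<open>The extremal function is z_0 * x with a unit vector x: its only term exceeds 1 as soon
  as |z_0| > 1, which happens in every polydisk of radius r > 1.\<close>

lemma r_p_le_1:
  assumes p: "0 < p" and n: "1 \<le> n" and y: "(y::'a::{complex_normed_vector,banach}) \<noteq> 0"
  shows "r_p p n TYPE('a) \<le> 1"
proof -
  define x where "x = (1 / norm y) *\<^sub>R y"
  have x: "norm x = 1" using y by (simp add: x_def)
  define e :: "nat \<Rightarrow> nat" where "e = (\<lambda>_. 0)(0 := 1)"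
  define c where "c = (\<lambda>\<alpha>. if \<alpha> = e then x else 0)"
  have e: "e \<in> multi_indices n" "e \<noteq> (\<lambda>_. 0)"
    using n by (auto simp: e_def multi_indices_def fun_eq_iff)
  have mono_e: "mono_pow n z e = z 0" for z :: "nat \<Rightarrow> complex"
  proof -
    have "mono_pow n z e = (\<Prod>i\<in>{0}. z i ^ e i)"
      unfolding mono_pow_def using n by (intro prod.mono_neutral_right) (auto simp: e_def)
    then show ?thesis by (simp add: e_def)
  qed
  have holo: "holo_powser n c (\<lambda>z. z 0 *\<^sub>C x)"
    unfolding holo_powser_def
  proof
    fix z :: "nat \<Rightarrow> complex"
    show "((\<lambda>\<alpha>. mono_pow n z \<alpha> *\<^sub>C c \<alpha>) has_sum z 0 *\<^sub>C x) (multi_indices n)"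
      by (rule has_sum_finite_neutralI[where B = "{e}"])
         (use e in \<open>auto simp: c_def mono_e scaleC.zero_right\<close>)
  qed
  have "norm (z 0 *\<^sub>C x) \<le> 1" if "z \<in> polydisk n" for z :: "nat \<Rightarrow> complex"
    using that n x by (auto simp: polydisk_def norm_scaleC intro: less_imp_le)
  then have "r_p p n TYPE('a) \<le> r_p_f p n c"
    unfolding r_p_def using holo by (intro Inf_lower) blast
  also have "r_p_f p n c \<le> 1"
    unfolding r_p_f_def
  proof (rule Sup_least, clarify)
    fix r :: real
    assume r: "0 \<le> r" and bohr: "bohr_cond p n c r"
    have "r \<le> 1"
    proof (rule ccontr)
      assume "\<not> r \<le> 1"
      then obtain s where s: "1 < s" "s < r" using dense[of 1 r] by auto
      define z where "z = (\<lambda>_::nat. 0 :: complex)(0 := of_real s)"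
      have z0: "z 0 = of_real s" by (simp add: z_def)
      define h where "h = (\<lambda>\<alpha>. ennreal (norm (mono_pow n z \<alpha> *\<^sub>C c \<alpha>) powr p))"
      have "(\<forall>i<n. cmod (z i) < r) \<and> (\<forall>i\<ge>n. z i = 0)"
        using s n by (auto simp: z_def)
      then have "ennreal (norm (c (\<lambda>_. 0)) powr p) + infsum h (multi_indices n - {\<lambda>_. 0}) \<le> 1"
        using bohr unfolding bohr_cond_def h_def by blast
      moreover have "infsum h (multi_indices n - {\<lambda>_. 0}) = h e"
        by (intro infsumI has_sum_finite_neutralI[where B = "{e}"])
           (use e in \<open>auto simp: h_def c_def scaleC.zero_right\<close>)
      ultimately have "h e \<le> 1"
        by (simp add: c_def e(2)[symmetric])
      then have "s powr p \<le> 1"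
        using s x by (simp add: h_def mono_e z0 c_def norm_scaleC)
      moreover have "1 < s powr p" using s p by simp
      ultimately show False by simp
    qed
    then show "ereal r \<le> 1" by simp
  qed
  finally show ?thesis .
qed

section \<open>Both bounds together\<close>

theorem theorem1p4:
  fixes p :: real and n :: nat
  assumes "2 \<le> p"
    and "p_unif_PL_convex p TYPE('a::{complex_normed_vector,banach})"
    and "cdim_ge2 TYPE('a)"
    and "1 \<le> n"
  shows "ereal ((I_p p TYPE('a) / (2 powr p + I_p p TYPE('a))) powr (2 / p)) \<le> r_p p n TYPE('a)
         \<and> r_p p n TYPE('a) \<le> 1"
proof -
  obtain x y :: 'a where xy: "\<forall>a b :: complex. a *\<^sub>C x + b *\<^sub>C y = 0 \<longrightarrow> a = 0 \<and> b = 0"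
    using assms(3) unfolding cdim_ge2_def by blast
  have y: "y \<noteq> 0"
    using xy[rule_format, of 0 1] by (auto simp: scaleC.zero_left scaleC.zero_right)
  have p: "0 < p" "1 \<le> p" using assms(1) by auto
  define I where "I = I_p p TYPE('a)"
  have I: "0 < I" "PL_ineq p I TYPE('a)"
    using PL_ineq_I_p[OF assms(2) p(1) y] by (simp_all add: I_def)
  define q where "q = I / (2 powr p + I)"
  define r where "r = q powr (2 / p)"
  have q: "0 < q" "q \<le> 1" using I by (auto simp: q_def divide_le_eq add_pos_pos)
  have r: "0 < r" using q by (simp add: r_def)
  \<comment> \<open>The exponent 2/p yields r^p = q^2, and q \<le> 1 brings this below the threshold
    q of the coefficient inequality.\<close>
  have "r powr p = q powr 2" using p by (simp add: r_def powr_powr)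
  also have "\<dots> \<le> q powr 1" using q by (intro powr_mono') auto
  finally have rp: "r powr p \<le> I / (2 powr p + I)" using q by (simp flip: q_def)
  have "ereal r \<le> r_p p n TYPE('a)"
    unfolding r_p_def
  proof (rule Inf_greatest, clarify)
    fix c :: "(nat \<Rightarrow> nat) \<Rightarrow> 'a" and f
    assume "holo_powser n c f" "\<forall>z\<in>polydisk n. norm (f z) \<le> 1"
    then have "bohr_cond p n c r"
      by (intro bohr_cond_of_bounded_holo_powser[OF I(2,1) p(2) r rp]) auto
    then show "ereal r \<le> r_p_f p n c"
      unfolding r_p_f_def using r by (intro Sup_upper) auto
  qed
  with r_p_le_1[OF p(1) assms(4) y] show ?thesis
    by (simp add: r_def q_def I_def)
qed

end
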